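(* For every integer $n\geq0$, \[ (q;q)_{2n}\,CP_{(3,1)}(n) = \sum_{r= -\infty}^\infty (-1)^r q^{r(3r+1)} {2 n\brack n-3r+\frac{(-1)^r-1}{2}}_q. \]
   Context: $(a;q)_m=\prod_{j=0}^{m-1}(1-aq^j)$; for integers $a,b$, ${a\brack b}_q=\frac{(q;q)_a}{(q;q)_b(q;q)_{a-b}}$ if $0\le b\le a$ and $0$ otherwise. A cylindric partition with profile $(c_1,c_2)$ is a pair of partitions $(\lambda^{(1)},\lambda^{(2)})$ (parts weakly decreasing, $\lambda^{(i)}_j=0$ beyond the number of parts) with $\lambda^{(1)}_j\ge\lambda^{(2)}_{j+c_2}$ and $\lambda^{(2)}_j\ge\lambda^{(1)}_{j+c_1}$ for all $j\ge1$; its size is $|\lambda^{(1)}|+|\lambda^{(2)}|$. $CP_{(3,1)}(n)$ is the generating function $\sum q^{\text{size}}$ over cylindric partitions of profile $(3,1)$ in which each partition has at most $n$ parts, with $CP_{(3,1)}(0)=1$. *)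

theory Defs
  imports "HOL-Analysis.Analysis" "HOL-Computational_Algebra.Formal_Power_Series"
begin

definition qpoch :: "'a::comm_ring_1 \<Rightarrow> 'a \<Rightarrow> nat \<Rightarrow> 'a" where
  "qpoch a q m = (\<Prod>j<m. 1 - a * q ^ j)"

(* Used at q = fps_X over a field, where the denominator has constant term 1,
   so the quotient is the product with its multiplicative inverse. *)
definition qbinom :: "'a::{comm_ring_1,inverse} \<Rightarrow> int \<Rightarrow> int \<Rightarrow> 'a" where
  "qbinom q a b =
     (if 0 \<le> b \<and> b \<le> a
      then qpoch q q (nat a) / (qpoch q q (nat b) * qpoch q q (nat (a - b)))
      else 0)"

(* A partition is the list of its (positive) parts, so that its number of parts is
   the length of the list and its size is sum_list. *)
definition is_partition :: "nat list \<Rightarrow> bool" where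
  "is_partition xs \<longleftrightarrow> sorted_wrt (\<ge>) xs \<and> (\<forall>x\<in>set xs. x > 0)"

(* parts are numbered from 1 *)
definition part :: "nat list \<Rightarrow> nat \<Rightarrow> nat" where
  "part xs j = (if 1 \<le> j \<and> j \<le> length xs then xs ! (j - 1) else 0)"

definition cylindric_partition :: "nat \<Rightarrow> nat \<Rightarrow> nat list \<times> nat list \<Rightarrow> bool" where
  "cylindric_partition c1 c2 = (\<lambda>(xs, ys).
     is_partition xs \<and> is_partition ys \<and>
     (\<forall>j\<ge>1. part xs j \<ge> part ys (j + c2)) \<and>
     (\<forall>j\<ge>1. part ys j \<ge> part xs (j + c1)))"

definition cylindric_partitions :: "nat \<Rightarrow> nat \<Rightarrow> nat \<Rightarrow> nat \<Rightarrow> (nat list \<times> nat list) set" where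
  "cylindric_partitions c1 c2 n k =
     {(xs, ys). cylindric_partition c1 c2 (xs, ys) \<and>
        length xs \<le> n \<and> length ys \<le> n \<and> sum_list xs + sum_list ys = k}"

definition CP :: "nat \<Rightarrow> nat \<Rightarrow> nat \<Rightarrow> rat fps" where
  "CP c1 c2 n = Abs_fps (\<lambda>k. of_nat (card (cylindric_partitions c1 c2 n k)))"

lemma finite_cylindric_partitions: "finite (cylindric_partitions c1 c2 n k)"
proof -
  let ?L = "{xs :: nat list. set xs \<subseteq> {..k} \<and> length xs \<le> n}"
  have "cylindric_partitions c1 c2 n k \<subseteq> ?L \<times> ?L"
  proof
    fix p assume "p \<in> cylindric_partitions c1 c2 n k"
    then obtain xs ys where p: "p = (xs, ys)" "length xs \<le> n" "length ys \<le> n"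
      "sum_list xs + sum_list ys = k"
      by (auto simp: cylindric_partitions_def)
    have "x \<le> k" if "x \<in> set xs" for x
      using member_le_sum_list[OF that] p(4) by linarith
    moreover have "y \<le> k" if "y \<in> set ys" for y
      using member_le_sum_list[OF that] p(4) by linarith
    ultimately show "p \<in> ?L \<times> ?L" using p by auto
  qed
  moreover have "finite (?L \<times> ?L)"
    by (intro finite_cartesian_product finite_lists_length_le) auto
  ultimately show ?thesis by (rule finite_subset)
qed

lemma CP_0: "CP c1 c2 0 = 1"
proof (rule fps_ext)
  fix k
  have "cylindric_partitions c1 c2 0 k = (if k = 0 then {([], [])} else {})"
    by (auto simp: cylindric_partitions_def cylindric_partition_def is_partition_def part_def)
  then show "fps_nth (CP c1 c2 0) k = fps_nth 1 k"
    by (simp add: CP_def)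
qed

end

theory Submission
  imports Defs
begin

text \<open>
  Let \<open>F a b\<close> count the cylindric partitions whose two components have at most \<open>a\<close> and \<open>b\<close>
  parts. Inclusion-exclusion on whether the last part of a component vanishes, together with
  subtracting 1 from every part, gives
  \<open>(1 - q^(a+b)) F a b = F (a-1) b + F a (b-1) - F (a-1) (b-1)\<close> inside the strip
  \<open>-c2 \<le> a - b \<le> c1\<close>, while the cylindric inequalities force \<open>F\<close> to be constant when one
  steps out of the strip. For every integer \<open>k\<close> the product \<open>1 / ((q;q)_(a-k) (q;q)_(b+k))\<close>
  solves the recurrence, and the alternating sum of such products obtained by reflecting \<open>k = 0\<close>
  in the two walls of the strip satisfies the boundary conditions. Put \<open>a = b = n\<close>.
\<close>

section \<open>The recurrence for cylindric partitions\<close>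

text \<open>Separate bounds for the two components, because the recurrence lowers them one at a
  time; only the diagonal is \<open>CP\<close>.\<close>

definition bounded_cyl :: "nat \<Rightarrow> nat \<Rightarrow> nat \<Rightarrow> nat \<Rightarrow> nat \<Rightarrow> (nat list \<times> nat list) set" where
  "bounded_cyl c1 c2 a b k =
     {(xs, ys). cylindric_partition c1 c2 (xs, ys) \<and>
        length xs \<le> a \<and> length ys \<le> b \<and> sum_list xs + sum_list ys = k}"

definition full_cyl :: "nat \<Rightarrow> nat \<Rightarrow> nat \<Rightarrow> nat \<Rightarrow> nat \<Rightarrow> (nat list \<times> nat list) set" where
  "full_cyl c1 c2 a b k =
     {(xs, ys). cylindric_partition c1 c2 (xs, ys) \<and>
        length xs = a \<and> length ys = b \<and> sum_list xs + sum_list ys = k}"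

definition bounded_cyl_gf :: "nat \<Rightarrow> nat \<Rightarrow> nat \<Rightarrow> nat \<Rightarrow> rat fps" where
  "bounded_cyl_gf c1 c2 a b = Abs_fps (\<lambda>k. of_nat (card (bounded_cyl c1 c2 a b k)))"

lemma bounded_cyl_gf_diag: "bounded_cyl_gf c1 c2 n n = CP c1 c2 n"
  by (simp add: bounded_cyl_gf_def CP_def bounded_cyl_def cylindric_partitions_def)

lemma finite_bounded_cyl: "finite (bounded_cyl c1 c2 a b k)"
  by (rule finite_subset[OF _ finite_cylindric_partitions[of c1 c2 "max a b" k]])
     (auto simp: bounded_cyl_def cylindric_partitions_def)

lemma finite_full_cyl: "finite (full_cyl c1 c2 a b k)"
  by (rule finite_subset[OF _ finite_bounded_cyl[of c1 c2 a b k]])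
     (auto simp: bounded_cyl_def full_cyl_def)

section \<open>Adding or removing one unit in every part\<close>

definition raise_parts :: "nat \<Rightarrow> nat list \<Rightarrow> nat list" where
  "raise_parts a xs = map Suc xs @ replicate (a - length xs) 1"

text \<open>Parts equal to 1 are dropped, since they would become zeros, which
  \<open>is_partition\<close> excludes; the padding in \<open>raise_parts\<close> restores
  them.\<close>

definition lower_parts :: "nat list \<Rightarrow> nat list" where
  "lower_parts xs = map (\<lambda>x. x - 1) (filter (\<lambda>x. x > 1) xs)"

lemma length_raise_parts: "length xs \<le> a \<Longrightarrow> length (raise_parts a xs) = a"
  by (simp add: raise_parts_def)

lemma sum_list_raise_parts:
  assumes "length xs \<le> a"
  shows "sum_list (raise_parts a xs) = sum_list xs + a"
proof -
  have "sum_list (map Suc xs) = sum_list xs + length xs"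
    by (induction xs) auto
  then show ?thesis using assms by (simp add: raise_parts_def sum_list_replicate)
qed

lemma part_raise_parts:
  assumes "length xs \<le> a"
  shows "part (raise_parts a xs) j = (if 1 \<le> j \<and> j \<le> a then Suc (part xs j) else 0)"
  using assms by (auto simp: part_def raise_parts_def nth_append)

lemma is_partition_raise_parts:
  assumes "is_partition xs"
  shows "is_partition (raise_parts a xs)"
proof -
  have "sorted_wrt (\<ge>) (replicate m (1 :: nat))" for m
    by (induction m) auto
  then show ?thesis
    using assms by (auto simp: is_partition_def raise_parts_def sorted_wrt_append sorted_wrt_map)
qed

lemma is_partition_lower_parts: "is_partition xs \<Longrightarrow> is_partition (lower_parts xs)"
  by (induction xs) (auto simp: is_partition_def lower_parts_def diff_le_mono)

lemma lower_raise_parts: "is_partition xs \<Longrightarrow> lower_parts (raise_parts a xs) = xs"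
  by (auto simp: is_partition_def lower_parts_def raise_parts_def filter_map o_def
      intro!: map_idI filter_True)

lemma length_lower_parts: "length (lower_parts xs) \<le> length xs"
  by (simp add: lower_parts_def)

lemma raise_lower_parts:
  assumes "is_partition xs"
  shows "raise_parts (length xs) (lower_parts xs) = xs"
  using assms
proof (induction xs)
  case Nil
  then show ?case by (simp add: lower_parts_def raise_parts_def)
next
  case (Cons x xs)
  have p: "is_partition xs" using Cons.prems by (simp add: is_partition_def)
  show ?case
  proof (cases "x > 1")
    case True
    then show ?thesis using Cons.IH[OF p] by (simp add: lower_parts_def raise_parts_def)
  next
    case False
    \<comment> \<open>Parts are positive and weakly decreasing, so a head that is at most 1 forces
      every part to be 1.\<close>
    then have one: "\<forall>y\<in>set (x # xs). y = 1"
      using Cons.prems by (fastforce simp: is_partition_def)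
    then have "lower_parts (x # xs) = []" by (auto simp: lower_parts_def filter_empty_conv)
    moreover have "replicate (length (x # xs)) 1 = x # xs"
      using one by (metis replicate_eqI)
    ultimately show ?thesis by (simp only: raise_parts_def list.map append_Nil list.size diff_zero)
  qed
qed

lemma part_eq_0: "length xs < j \<Longrightarrow> part xs j = 0"
  by (simp add: part_def)

text \<open>Inside the strip, whenever the smaller side of an inequality is raised, so is the larger
  side; hence no inequality is gained or lost.\<close>

lemma cylindric_raise_parts_iff:
  assumes "length xs \<le> a" "length ys \<le> b" "b \<le> a + c2" "a \<le> b + c1"
    and "is_partition xs" "is_partition ys"
  shows "cylindric_partition c1 c2 (raise_parts a xs, raise_parts b ys) \<longleftrightarrow>
         cylindric_partition c1 c2 (xs, ys)"
proof -
  have *: "(\<forall>j\<ge>1. part (raise_parts s us) j \<ge> part (raise_parts t vs) (j + c)) \<longleftrightarrow>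
           (\<forall>j\<ge>1. part us j \<ge> part vs (j + c))"
    if "length us \<le> s" "length vs \<le> t" "t \<le> s + c" for us vs s t c
  proof (intro iff_allI imp_cong refl)
    fix j :: nat assume "1 \<le> j"
    then show "part (raise_parts s us) j \<ge> part (raise_parts t vs) (j + c) \<longleftrightarrow>
               part us j \<ge> part vs (j + c)"
      \<comment> \<open>If \<open>j + c\<close> exceeds \<open>t\<close>, both right-hand parts are
        0; otherwise \<open>t \<le> s + c\<close> gives \<open>j \<le> s\<close>, and both parts
        grow by 1.\<close>
      using that part_eq_0[of vs "j + c"] by (cases "j + c \<le> t") (auto simp: part_raise_parts)
  qed
  show ?thesis
    using assms *[of xs a ys b c2] *[of ys b xs a c1]
    by (simp add: cylindric_partition_def is_partition_raise_parts)
qed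

lemma card_full_cyl:
  assumes "b \<le> a + c2" "a \<le> b + c1"
  shows "card (full_cyl c1 c2 a b k) =
         (if a + b \<le> k then card (bounded_cyl c1 c2 a b (k - (a + b))) else 0)"
proof (cases "a + b \<le> k")
  case True
  have lower: "length (lower_parts xs) \<le> length xs \<and>
      sum_list (lower_parts xs) + length xs = sum_list xs" if "is_partition xs" for xs
    using sum_list_raise_parts[OF length_lower_parts, of xs] raise_lower_parts[OF that]
      length_lower_parts[of xs] by simp
  have "bij_betw (\<lambda>(xs, ys). (raise_parts a xs, raise_parts b ys))
      (bounded_cyl c1 c2 a b (k - (a + b))) (full_cyl c1 c2 a b k)"
  proof (rule bij_betw_byWitness[where f' = "\<lambda>(xs, ys). (lower_parts xs, lower_parts ys)"])
    show "\<forall>p\<in>bounded_cyl c1 c2 a b (k - (a + b)). (case case p of (xs, ys) \<Rightarrow>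
        (raise_parts a xs, raise_parts b ys) of (xs, ys) \<Rightarrow> (lower_parts xs, lower_parts ys)) = p"
      by (auto simp: bounded_cyl_def cylindric_partition_def lower_raise_parts)
    show "\<forall>p\<in>full_cyl c1 c2 a b k. (case case p of (xs, ys) \<Rightarrow>
        (lower_parts xs, lower_parts ys) of (xs, ys) \<Rightarrow> (raise_parts a xs, raise_parts b ys)) = p"
      by (auto simp: full_cyl_def cylindric_partition_def raise_lower_parts)
    show "(\<lambda>(xs, ys). (raise_parts a xs, raise_parts b ys)) ` bounded_cyl c1 c2 a b (k - (a + b))
        \<subseteq> full_cyl c1 c2 a b k"
    proof clarify
      fix xs ys assume *: "(xs, ys) \<in> bounded_cyl c1 c2 a b (k - (a + b))"
      then have "is_partition xs" "is_partition ys"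
        by (auto simp: bounded_cyl_def cylindric_partition_def)
      with * True assms show "(raise_parts a xs, raise_parts b ys) \<in> full_cyl c1 c2 a b k"
        by (auto simp add: bounded_cyl_def full_cyl_def cylindric_raise_parts_iff
            length_raise_parts sum_list_raise_parts)
    qed
    show "(\<lambda>(xs, ys). (lower_parts xs, lower_parts ys)) ` full_cyl c1 c2 a b k
        \<subseteq> bounded_cyl c1 c2 a b (k - (a + b))"
    proof clarify
      fix xs ys assume *: "(xs, ys) \<in> full_cyl c1 c2 a b k"
      then have p: "is_partition xs" "is_partition ys" and l: "length xs = a" "length ys = b"
        and c: "cylindric_partition c1 c2 (xs, ys)" and s: "sum_list xs + sum_list ys = k"
        by (auto simp: full_cyl_def cylindric_partition_def)
      note low = lower[OF p(1)] lower[OF p(2)]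
      have "cylindric_partition c1 c2 (lower_parts xs, lower_parts ys)"
        using cylindric_raise_parts_iff[of "lower_parts xs" a "lower_parts ys" b c2 c1]
          raise_lower_parts[OF p(1)] raise_lower_parts[OF p(2)] low l c assms
          is_partition_lower_parts[OF p(1)] is_partition_lower_parts[OF p(2)] by simp
      then show "(lower_parts xs, lower_parts ys) \<in> bounded_cyl c1 c2 a b (k - (a + b))"
        using low l s by (auto simp: bounded_cyl_def)
    qed
  qed
  then show ?thesis using True by (simp add: bij_betw_same_card)
next
  case False
  have "sum_list (xs :: nat list) \<ge> length xs" if "is_partition xs" for xs
    using sum_list_raise_parts[OF length_lower_parts, of xs] raise_lower_parts[OF that] by simp
  then have "a + b \<le> k" if "(xs, ys) \<in> full_cyl c1 c2 a b k" for xs ys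
    using that by (auto simp: full_cyl_def cylindric_partition_def intro: add_mono)
  then have "full_cyl c1 c2 a b k = {}"
    using False by auto
  then show ?thesis using False by simp
qed

lemma full_cyl_gf:
  assumes "b \<le> a + c2" "a \<le> b + c1"
  shows "Abs_fps (\<lambda>k. of_nat (card (full_cyl c1 c2 a b k)) :: rat) =
         fps_X ^ (a + b) * bounded_cyl_gf c1 c2 a b"
  by (rule fps_ext) (simp add: card_full_cyl[OF assms] bounded_cyl_gf_def fps_X_power_mult_nth)

text \<open>Only the corner must lie in the strip. Its neighbours may be one step outside, where the
  wall lemmas apply.\<close>

lemma bounded_cyl_gf_rec:
  assumes "Suc b \<le> Suc a + c2" "Suc a \<le> Suc b + c1"
  shows "(1 - fps_X ^ (Suc a + Suc b)) * bounded_cyl_gf c1 c2 (Suc a) (Suc b) =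
         bounded_cyl_gf c1 c2 a (Suc b) + bounded_cyl_gf c1 c2 (Suc a) b
         - bounded_cyl_gf c1 c2 a b"
proof -
  let ?S = "bounded_cyl c1 c2" and ?E = "full_cyl c1 c2 (Suc a) (Suc b)"
  have "card (?S (Suc a) (Suc b) k) + card (?S a b k) =
        card (?S a (Suc b) k) + card (?S (Suc a) b k) + card (?E k)" for k
  proof -
    have u: "?S (Suc a) (Suc b) k = (?S a (Suc b) k \<union> ?S (Suc a) b k) \<union> ?E k"
      by (auto simp: bounded_cyl_def full_cyl_def)
    have i: "?S a (Suc b) k \<inter> ?S (Suc a) b k = ?S a b k"
      by (auto simp: bounded_cyl_def)
    have d: "(?S a (Suc b) k \<union> ?S (Suc a) b k) \<inter> ?E k = {}"
      by (auto simp: bounded_cyl_def full_cyl_def)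
    show ?thesis
      using card_Un_Int[OF finite_bounded_cyl finite_bounded_cyl, of c1 c2 a "Suc b" k c1 c2 "Suc a" b k]
        card_Un_disjoint[OF _ finite_full_cyl d] u i finite_bounded_cyl by simp
  qed
  then have "bounded_cyl_gf c1 c2 (Suc a) (Suc b) + bounded_cyl_gf c1 c2 a b =
      bounded_cyl_gf c1 c2 a (Suc b) + bounded_cyl_gf c1 c2 (Suc a) b
      + Abs_fps (\<lambda>k. of_nat (card (?E k)))"
    by (intro fps_ext) (simp add: bounded_cyl_gf_def flip: of_nat_add)
  then show ?thesis using full_cyl_gf[OF assms] by (simp add: algebra_simps)
qed

text \<open>With the second component empty there is only one bound to lower, so inclusion-exclusion
  reduces to a single term.\<close>

lemma bounded_cyl_gf_rec_left:
  assumes "Suc a \<le> c1"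
  shows "(1 - fps_X ^ Suc a) * bounded_cyl_gf c1 c2 (Suc a) 0 = bounded_cyl_gf c1 c2 a 0"
proof -
  have "card (bounded_cyl c1 c2 (Suc a) 0 k) =
        card (bounded_cyl c1 c2 a 0 k) + card (full_cyl c1 c2 (Suc a) 0 k)" for k
    by (subst card_Un_disjoint[OF finite_bounded_cyl finite_full_cyl, symmetric])
       (auto simp: bounded_cyl_def full_cyl_def intro!: arg_cong[where f = card])
  then have "bounded_cyl_gf c1 c2 (Suc a) 0 =
      bounded_cyl_gf c1 c2 a 0 + Abs_fps (\<lambda>k. of_nat (card (full_cyl c1 c2 (Suc a) 0 k)))"
    by (intro fps_ext) (simp add: bounded_cyl_gf_def)
  then show ?thesis
    using full_cyl_gf[of 0 "Suc a" c2 c1] assms by (simp add: algebra_simps)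
qed

lemma bounded_cyl_gf_rec_right:
  assumes "Suc b \<le> c2"
  shows "(1 - fps_X ^ Suc b) * bounded_cyl_gf c1 c2 0 (Suc b) = bounded_cyl_gf c1 c2 0 b"
proof -
  have "card (bounded_cyl c1 c2 0 (Suc b) k) =
        card (bounded_cyl c1 c2 0 b k) + card (full_cyl c1 c2 0 (Suc b) k)" for k
    by (subst card_Un_disjoint[OF finite_bounded_cyl finite_full_cyl, symmetric])
       (auto simp: bounded_cyl_def full_cyl_def intro!: arg_cong[where f = card])
  then have "bounded_cyl_gf c1 c2 0 (Suc b) =
      bounded_cyl_gf c1 c2 0 b + Abs_fps (\<lambda>k. of_nat (card (full_cyl c1 c2 0 (Suc b) k)))"
    by (intro fps_ext) (simp add: bounded_cyl_gf_def)
  then show ?thesis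
    using full_cyl_gf[of "Suc b" 0 c2 c1] assms by (simp add: algebra_simps)
qed

section \<open>Behaviour at the walls of the strip\<close>

lemma part_last_pos: "is_partition xs \<Longrightarrow> length xs = Suc m \<Longrightarrow> part xs (Suc m) > 0"
  by (simp add: is_partition_def part_def)

text \<open>A second component of length \<open>Suc (a + c2)\<close> would have a positive last part
  bounded by part \<open>Suc a\<close> of the first, which is 0.\<close>

lemma bounded_cyl_gf_wall_right:
  "bounded_cyl_gf c1 c2 a (Suc (a + c2)) = bounded_cyl_gf c1 c2 a (a + c2)"
proof -
  have "length ys \<noteq> Suc (a + c2)"
    if "cylindric_partition c1 c2 (xs, ys)" "length xs \<le> a" for xs ys
  proof
    assume l: "length ys = Suc (a + c2)"
    have "part ys (Suc a + c2) \<le> part xs (Suc a)"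
      using that(1) by (auto simp: cylindric_partition_def)
    then show False
      using that l part_last_pos[OF _ l] part_eq_0[of xs "Suc a"]
      by (simp add: cylindric_partition_def)
  qed
  then have "bounded_cyl c1 c2 a (Suc (a + c2)) k = bounded_cyl c1 c2 a (a + c2) k" for k
    by (fastforce simp: bounded_cyl_def le_Suc_eq)
  then show ?thesis by (simp add: bounded_cyl_gf_def)
qed

lemma bounded_cyl_gf_wall_left:
  "bounded_cyl_gf c1 c2 (Suc (b + c1)) b = bounded_cyl_gf c1 c2 (b + c1) b"
proof -
  have "length xs \<noteq> Suc (b + c1)"
    if "cylindric_partition c1 c2 (xs, ys)" "length ys \<le> b" for xs ys
  proof
    assume l: "length xs = Suc (b + c1)"
    have "part xs (Suc b + c1) \<le> part ys (Suc b)"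
      using that(1) by (auto simp: cylindric_partition_def)
    then show False
      using that l part_last_pos[OF _ l] part_eq_0[of ys "Suc b"]
      by (simp add: cylindric_partition_def)
  qed
  then have "bounded_cyl c1 c2 (Suc (b + c1)) b k = bounded_cyl c1 c2 (b + c1) b k" for k
    by (fastforce simp: bounded_cyl_def le_Suc_eq)
  then show ?thesis by (simp add: bounded_cyl_gf_def)
qed

section \<open>The alternating sum\<close>

text \<open>The convention 1/(q;q)_m = 0 for negative m makes \<open>inv_qpoch_step\<close> hold for
  all integers and leaves finitely many nonzero terms in the bilateral sums.\<close>

definition inv_qpoch :: "int \<Rightarrow> rat fps" where
  "inv_qpoch m = (if m < 0 then 0 else inverse (qpoch fps_X fps_X (nat m)))"

lemma qpoch_fps_X_nth_0: "fps_nth (qpoch fps_X fps_X m :: rat fps) 0 = 1"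
  by (induction m) (simp_all add: qpoch_def)

lemma inv_qpoch_step: "(1 - fps_X ^ nat m) * inv_qpoch m = inv_qpoch (m - 1)"
proof (cases "m \<le> 0")
  case True
  then show ?thesis by (simp add: inv_qpoch_def)
next
  case False
  define j where "j = nat (m - 1)"
  have m: "m = int (Suc j)" using False by (simp add: j_def)
  have "fps_nth (1 - fps_X ^ Suc j :: rat fps) 0 = 1" by simp
  then have "(1 - fps_X ^ Suc j) * inverse (1 - fps_X ^ Suc j :: rat fps) = 1"
    by (metis inverse_mult_eq_1' zero_neq_one)
  moreover have "inverse (qpoch fps_X fps_X (Suc j) :: rat fps) =
      inverse (qpoch fps_X fps_X j) * inverse (1 - fps_X ^ Suc j)"
    by (simp add: qpoch_def fps_inverse_mult)
  moreover have "nat m = Suc j" "nat (m - 1) = j" "\<not> m < 0" "\<not> m - 1 < 0"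
    using m by simp_all
  ultimately show ?thesis
    by (simp add: inv_qpoch_def mult.left_commute del: power_Suc)
qed

text \<open>
  The values of \<open>refl_shift\<close> are the orbit of 0 under \<open>k \<mapsto> -2 - k\<close> and \<open>k \<mapsto> 4 - k\<close>, the
  reflections in the walls \<open>b = a + 2\<close> and \<open>a = b + 4\<close> for profile (3,1).
\<close>

definition refl_shift :: "int \<Rightarrow> int" where
  "refl_shift r = (if even r then - 3 * r else 3 * r + 1)"

text \<open>The sign is the parity of the number of reflections; the power of q is what makes
  reflected terms cancel at both walls.\<close>

definition refl_coeff :: "int \<Rightarrow> rat fps" where
  "refl_coeff r = (-1) ^ nat \<bar>r\<bar> * fps_X ^ nat (r * (3 * r + 1))"

definition refl_term :: "int \<Rightarrow> int \<Rightarrow> int \<Rightarrow> rat fps" where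
  "refl_term a b r =
     refl_coeff r * inv_qpoch (a - refl_shift r) * inv_qpoch (b + refl_shift r)"

definition refl_sum :: "int \<Rightarrow> int \<Rightarrow> rat fps" where
  "refl_sum a b = (\<Sum>r\<in>{-\<bar>a\<bar>-\<bar>b\<bar>..\<bar>a\<bar>+\<bar>b\<bar>}. refl_term a b r)"

lemma refl_term_eq_0:
  assumes "\<bar>r\<bar> > \<bar>a\<bar> + \<bar>b\<bar>"
  shows "refl_term a b r = 0"
proof -
  have "\<bar>refl_shift r\<bar> \<ge> \<bar>r\<bar>" by (auto simp: refl_shift_def)
  then have "a - refl_shift r < 0 \<or> b + refl_shift r < 0" using assms by linarith
  then show ?thesis by (auto simp: refl_term_def inv_qpoch_def)
qed

text \<open>Allows sums with different ranges to be compared term by term over one common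
  range.\<close>

lemma refl_sum_eq:
  assumes "finite R" "{-\<bar>a\<bar>-\<bar>b\<bar>..\<bar>a\<bar>+\<bar>b\<bar>} \<subseteq> R"
  shows "refl_sum a b = sum (refl_term a b) R"
  unfolding refl_sum_def
  using assms by (intro sum.mono_neutral_left) (auto intro!: refl_term_eq_0)

text \<open>With x = q^u and y = q^v, where u + v = a + b for every shift, this is (1 - x) + (1 - y)
  - (1 - x)(1 - y) = 1 - xy.\<close>

lemma refl_term_rec:
  assumes "a + b \<ge> 0"
  shows "(1 - fps_X ^ nat (a + b)) * refl_term a b r =
    refl_term (a - 1) b r + refl_term a (b - 1) r - refl_term (a - 1) (b - 1) r"
proof -
  define u v where "u = a - refl_shift r" and "v = b + refl_shift r"
  have T: "refl_term a b r = refl_coeff r * inv_qpoch u * inv_qpoch v"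
    "refl_term (a - 1) b r = refl_coeff r * inv_qpoch (u - 1) * inv_qpoch v"
    "refl_term a (b - 1) r = refl_coeff r * inv_qpoch u * inv_qpoch (v - 1)"
    "refl_term (a - 1) (b - 1) r = refl_coeff r * inv_qpoch (u - 1) * inv_qpoch (v - 1)"
    by (simp_all add: refl_term_def u_def v_def algebra_simps)
  show ?thesis
  proof (cases "u < 0 \<or> v < 0")
    case True
    then show ?thesis unfolding T by (auto simp: inv_qpoch_def)
  next
    case False
    have "nat (a + b) = nat u + nat v" using False by (simp add: u_def v_def nat_add_distrib[symmetric])
    then show ?thesis
      unfolding T inv_qpoch_step[symmetric] by (simp add: power_add algebra_simps)
  qed
qed

lemma refl_sum_rec:
  assumes "a + b \<ge> 0"
  shows "(1 - fps_X ^ nat (a + b)) * refl_sum a b =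
    refl_sum (a - 1) b + refl_sum a (b - 1) - refl_sum (a - 1) (b - 1)"
proof -
  define R where "R = {-\<bar>a\<bar>-\<bar>b\<bar>-2..\<bar>a\<bar>+\<bar>b\<bar>+2}"
  have "refl_sum s t = sum (refl_term s t) R" if "s \<in> {a - 1, a}" "t \<in> {b - 1, b}" for s t
    using that by (intro refl_sum_eq) (auto simp: R_def)
  then show ?thesis
    by (simp add: sum_distrib_left refl_term_rec[OF assms] sum.distrib sum_subtractf)
qed

text \<open>Reindexing along the involution shows that the sum is its own negative, which forces 0
  over the rationals.\<close>

lemma sum_eq_0_of_sign_reversing:
  fixes f :: "'a \<Rightarrow> rat fps"
  assumes "\<And>r. r \<in> R \<Longrightarrow> s r \<in> R" "\<And>r. r \<in> R \<Longrightarrow> s (s r) = r" "\<And>r. r \<in> R \<Longrightarrow> f (s r) = - f r"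
  shows "sum f R = 0"
proof -
  have "sum f R = (\<Sum>r\<in>R. - f r)"
    by (rule sum.reindex_bij_witness[where i = s and j = s]) (use assms in auto)
  then have "sum f R = - sum f R" by (simp add: sum_negf)
  then have "fps_nth (sum f R) k = - fps_nth (sum f R) k" for k
    by (metis fps_neg_nth)
  then show ?thesis by (intro fps_ext) simp
qed

lemma minus_one_power_nat_abs: "(-1) ^ nat \<bar>r\<bar> = (if even r then 1 else - 1 :: 'a::ring_1)"
  by (simp add: even_nat_iff uminus_power_if)

text \<open>The difference of the two summands is \<open>refl_coeff r\<close> times q^v / ((q;q)_u
  (q;q)_v). Reflection in the wall swaps u and v and flips the sign, so these differences cancel in
  pairs.\<close>

lemma refl_sum_wall_right: "refl_sum a (a + 2) = refl_sum a (a + 1)"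
proof -
  define f where "f r = refl_term a (a + 2) r - refl_term a (a + 1) r" for r
  \<comment> \<open>This is k \<mapsto> -2 - k read on the index: it swaps 2j and 2j - 1.\<close>
  define s where "s r = (if even r then r - 1 else r + 1)" for r :: int
  define N where "N = \<bar>a\<bar> + \<bar>a + 1\<bar> + \<bar>a + 2\<bar>"
  \<comment> \<open>An odd left end and an even right end make the range a union of such
    pairs.\<close>
  define R where "R = {- 2 * N - 1..2 * N}"
  have f: "f r = refl_coeff r * fps_X ^ nat (a + 2 + refl_shift r) *
      (inv_qpoch (a - refl_shift r) * inv_qpoch (a + 2 + refl_shift r))" for r
  proof -
    have "a + 1 + refl_shift r = a + 2 + refl_shift r - 1" by simp
    then show ?thesis
      unfolding f_def refl_term_def by (simp only: inv_qpoch_step[symmetric]) algebra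
  qed
  have "sum f R = 0"
  proof (rule sum_eq_0_of_sign_reversing[where s = s])
    fix r assume "r \<in> R"
    show "s (s r) = r" by (simp add: s_def)
    show "s r \<in> R" using \<open>r \<in> R\<close> by (auto simp: s_def R_def; presburger)
    have sh: "refl_shift (s r) = - 2 - refl_shift r" by (simp add: refl_shift_def s_def)
    define u v where "u = a - refl_shift r" and "v = a + 2 + refl_shift r"
    have uv: "a - refl_shift (s r) = v" "a + 2 + refl_shift (s r) = u"
      by (simp_all add: sh u_def v_def)
    show "f (s r) = - f r"
    proof (cases "u < 0 \<or> v < 0")
      case True
      then show ?thesis unfolding f uv by (auto simp: inv_qpoch_def u_def v_def)
    next
      case False
      have nn: "t * (3 * t + 1) \<ge> 0" for t :: int
        by (cases "t \<ge> 0") (auto intro: mult_nonpos_nonpos)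
      \<comment> \<open>The balance of exponents that dictates the form of
        \<open>refl_coeff\<close>.\<close>
      have "s r * (3 * s r + 1) + u = r * (3 * r + 1) + v"
        by (simp add: s_def u_def v_def refl_shift_def algebra_simps)
      then have e: "nat (s r * (3 * s r + 1)) + nat u = nat (r * (3 * r + 1)) + nat v"
        using False nn[of r] nn[of "s r"] by linarith
      have "refl_coeff (s r) * fps_X ^ nat u = - (refl_coeff r * fps_X ^ nat v)"
        unfolding refl_coeff_def mult.assoc power_add[symmetric] e
        by (simp add: minus_one_power_nat_abs s_def)
      then show ?thesis unfolding f uv by (simp add: u_def v_def mult_ac)
    qed
  qed
  moreover have "refl_sum a t = sum (refl_term a t) R" if "t \<in> {a + 1, a + 2}" for t
  proof (rule refl_sum_eq)
    have "\<bar>a\<bar> + \<bar>t\<bar> \<le> N" "0 \<le> N" using that by (auto simp: N_def)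
    then show "{-\<bar>a\<bar>-\<bar>t\<bar>..\<bar>a\<bar>+\<bar>t\<bar>} \<subseteq> R" by (auto simp: R_def)
  qed (simp add: R_def)
  ultimately show ?thesis by (simp add: f_def sum_subtractf)
qed

lemma refl_sum_wall_left: "refl_sum (b + 4) b = refl_sum (b + 3) b"
proof -
  define f where "f r = refl_term (b + 4) b r - refl_term (b + 3) b r" for r
  \<comment> \<open>Here k \<mapsto> 4 - k swaps 2j and 2j + 1, so the range below starts at an even
    number and ends at an odd one.\<close>
  define s where "s r = (if even r then r + 1 else r - 1)" for r :: int
  define N where "N = \<bar>b\<bar> + \<bar>b + 3\<bar> + \<bar>b + 4\<bar>"
  define R where "R = {- 2 * N..2 * N + 1}"
  have f: "f r = refl_coeff r * fps_X ^ nat (b + 4 - refl_shift r) *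
      (inv_qpoch (b + 4 - refl_shift r) * inv_qpoch (b + refl_shift r))" for r
  proof -
    have "b + 3 - refl_shift r = b + 4 - refl_shift r - 1" by simp
    then show ?thesis
      unfolding f_def refl_term_def by (simp only: inv_qpoch_step[symmetric]) algebra
  qed
  have "sum f R = 0"
  proof (rule sum_eq_0_of_sign_reversing[where s = s])
    fix r assume "r \<in> R"
    show "s (s r) = r" by (simp add: s_def)
    show "s r \<in> R" using \<open>r \<in> R\<close> by (auto simp: s_def R_def; presburger)
    have sh: "refl_shift (s r) = 4 - refl_shift r" by (simp add: refl_shift_def s_def)
    define u v where "u = b + 4 - refl_shift r" and "v = b + refl_shift r"
    have uv: "b + 4 - refl_shift (s r) = v" "b + refl_shift (s r) = u"
      by (simp_all add: sh u_def v_def)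
    show "f (s r) = - f r"
    proof (cases "u < 0 \<or> v < 0")
      case True
      then show ?thesis unfolding f uv by (auto simp: inv_qpoch_def u_def v_def)
    next
      case False
      have nn: "t * (3 * t + 1) \<ge> 0" for t :: int
        by (cases "t \<ge> 0") (auto intro: mult_nonpos_nonpos)
      have "s r * (3 * s r + 1) + v = r * (3 * r + 1) + u"
        by (simp add: s_def u_def v_def refl_shift_def algebra_simps)
      then have e: "nat (s r * (3 * s r + 1)) + nat v = nat (r * (3 * r + 1)) + nat u"
        using False nn[of r] nn[of "s r"] by linarith
      have "refl_coeff (s r) * fps_X ^ nat v = - (refl_coeff r * fps_X ^ nat u)"
        unfolding refl_coeff_def mult.assoc power_add[symmetric] e
        by (simp add: minus_one_power_nat_abs s_def)
      then show ?thesis unfolding f uv by (simp add: u_def v_def mult_ac)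
    qed
  qed
  moreover have "refl_sum t b = sum (refl_term t b) R" if "t \<in> {b + 3, b + 4}" for t
  proof (rule refl_sum_eq)
    have "\<bar>b\<bar> + \<bar>t\<bar> \<le> N" "0 \<le> N" using that by (auto simp: N_def)
    then show "{-\<bar>t\<bar>-\<bar>b\<bar>..\<bar>t\<bar>+\<bar>b\<bar>} \<subseteq> R" by (auto simp: R_def)
  qed (simp add: R_def)
  ultimately show ?thesis by (simp add: f_def sum_subtractf)
qed

text \<open>Every other point of the orbit is at most -2 or at least 4, so one factor vanishes. This
  provides the values on the axes.\<close>

lemma refl_sum_single:
  assumes "b < 2" "a < 4"
  shows "refl_sum a b = inv_qpoch a * inv_qpoch b"
proof -
  have "refl_term a b r = 0" if "r \<noteq> 0" for r
  proof -
    have "refl_shift r \<le> -2 \<or> refl_shift r \<ge> 4"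
      using that by (auto simp: refl_shift_def; presburger)
    then show ?thesis using assms by (auto simp: refl_term_def inv_qpoch_def)
  qed
  then have "refl_sum a b = (\<Sum>r\<in>{0}. refl_term a b r)"
    unfolding refl_sum_def by (intro sum.mono_neutral_right) auto
  then show ?thesis by (simp add: refl_term_def refl_coeff_def refl_shift_def)
qed

section \<open>The generating function for profile (3,1)\<close>

lemma one_minus_fps_X_power_neq_0: "m > 0 \<Longrightarrow> (1 - fps_X ^ m :: rat fps) \<noteq> 0"
proof -
  assume "m > 0"
  then have "fps_nth (1 - fps_X ^ m :: rat fps) 0 = 1" by simp
  then show ?thesis by (metis fps_zero_nth zero_neq_one)
qed

lemma bounded_cyl_gf_0_0: "bounded_cyl_gf c1 c2 0 0 = 1"
  by (simp add: bounded_cyl_gf_diag CP_0)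

text \<open>Induction on \<open>a + b\<close>. The range includes the lines one step outside the
  strip, so that all neighbours of a point of the strip are covered.\<close>

lemma bounded_cyl_gf_eq_refl_sum:
  assumes "b \<le> a + 2" "a \<le> b + 4"
  shows "bounded_cyl_gf 3 1 a b = refl_sum (int a) (int b)"
  using assms
proof (induction "a + b" arbitrary: a b rule: less_induct)
  case less
  show ?case
  \<comment> \<open>On these lines both sides equal their values one step inside, where
    \<open>a + b\<close> is smaller.\<close>
  proof (cases "b = a + 2 \<or> a = b + 4")
    case True
    then show ?thesis
    proof
      assume b: "b = a + 2"
      then show ?thesis
        using bounded_cyl_gf_wall_right[of 3 1 a] refl_sum_wall_right[of "int a"]
          less.hyps[of a "a + 1"] by (simp add: add.commute)
    next
      assume a: "a = b + 4"
      then show ?thesis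
        using bounded_cyl_gf_wall_left[of 3 1 b] refl_sum_wall_left[of "int b"]
          less.hyps[of "b + 3" b] by (simp add: add.commute)
    qed
  next
    case False
    with less.prems have band: "b \<le> a + 1" "a \<le> b + 3" by auto
    have init: "inv_qpoch 0 = 1" by (simp add: inv_qpoch_def qpoch_def)
    consider "a = 0" "b = 0" | a' where "a = Suc a'" "b = 0" | b' where "a = 0" "b = Suc b'"
      | a' b' where "a = Suc a'" "b = Suc b'"
      by (cases a; cases b) auto
    then show ?thesis
    proof cases
      case 1
      then show ?thesis by (simp add: bounded_cyl_gf_0_0 refl_sum_single init)
    next
      case (2 a')
      have "(1 - fps_X ^ a) * bounded_cyl_gf 3 1 a b = (1 - fps_X ^ a) * refl_sum (int a) (int b)"
        using bounded_cyl_gf_rec_left[of a' 3 1] less.hyps[of a' 0] inv_qpoch_step[of "int a"]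
          2 band by (simp add: refl_sum_single init nat_add_distrib del: power_Suc)
      then show ?thesis using one_minus_fps_X_power_neq_0[of a] 2 by (simp del: power_Suc)
    next
      case (3 b')
      have "(1 - fps_X ^ b) * bounded_cyl_gf 3 1 a b = (1 - fps_X ^ b) * refl_sum (int a) (int b)"
        using bounded_cyl_gf_rec_right[of b' 1 3] less.hyps[of 0 b'] inv_qpoch_step[of "int b"]
          3 band by (simp add: refl_sum_single init nat_add_distrib del: power_Suc)
      then show ?thesis using one_minus_fps_X_power_neq_0[of b] 3 by (simp del: power_Suc)
    next
      case (4 a' b')
      have n: "nat (int a + int b) = a + b" by simp
      have i: "int a - 1 = int a'" "int b - 1 = int b'" using 4 by simp_all
      have "(1 - fps_X ^ (a + b)) * bounded_cyl_gf 3 1 a b =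
          bounded_cyl_gf 3 1 a' b + bounded_cyl_gf 3 1 a b' - bounded_cyl_gf 3 1 a' b'"
        using bounded_cyl_gf_rec[of b' a' 1 3] 4 band by simp
      also have "\<dots> = refl_sum a' b + refl_sum a b' - refl_sum a' b'"
        using less.hyps[of a' b] less.hyps[of a b'] less.hyps[of a' b'] 4 band by simp
      also have "\<dots> = (1 - fps_X ^ (a + b)) * refl_sum a b"
        using refl_sum_rec[of "int a" "int b"] unfolding n i by simp
      finally show ?thesis using one_minus_fps_X_power_neq_0[of "a + b"] 4 by simp
    qed
  qed
qed

text \<open>
  For even \<open>r\<close> the lower index of the theorem is \<open>n - 3 r\<close>, whereas \<open>refl_shift r = - 3 r\<close>
  calls for \<open>n + 3 r\<close>; the two agree only by the symmetry of the binomial, i.e. because \<open>a = b\<close>.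
\<close>

lemma qbinom_refl_shift:
  "qbinom fps_X (2 * int n) (int n - 3 * r + ((-1) ^ nat \<bar>r\<bar> - 1) div 2) =
   qpoch fps_X fps_X (2 * n) *
     (inv_qpoch (int n - refl_shift r) * inv_qpoch (int n + refl_shift r))"
proof -
  \<comment> \<open>The index n - k lies outside 0..2n exactly when n - k or n + k is negative, so
    the zero conventions of \<open>qbinom\<close> and \<open>inv_qpoch\<close> agree.\<close>
  have *: "qbinom fps_X (2 * int n) (int n - k) =
      qpoch fps_X fps_X (2 * n) * (inv_qpoch (int n - k) * inv_qpoch (int n + k))" for k
    by (auto simp: qbinom_def inv_qpoch_def fps_divide_unit qpoch_fps_X_nth_0 fps_inverse_mult
        nat_mult_distrib algebra_simps)
  show ?thesis
    using *[of "3 * r"] *[of "3 * r + 1"]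
    by (simp add: minus_one_power_nat_abs refl_shift_def mult.commute algebra_simps)
qed

theorem theorem5p5:
  fixes n :: nat
  shows "((\<lambda>r::int. (-1) ^ nat \<bar>r\<bar> * fps_X ^ nat (r * (3 * r + 1)) *
             qbinom fps_X (2 * int n) (int n - 3 * r + ((-1) ^ nat \<bar>r\<bar> - 1) div 2))
          has_sum (qpoch fps_X fps_X (2 * n) * CP 3 1 n)) UNIV"
proof -
  let ?f = "\<lambda>r::int. (-1) ^ nat \<bar>r\<bar> * fps_X ^ nat (r * (3 * r + 1)) *
             qbinom fps_X (2 * int n) (int n - 3 * r + ((-1) ^ nat \<bar>r\<bar> - 1) div 2) :: rat fps"
  let ?R = "{- \<bar>int n\<bar> - \<bar>int n\<bar>..\<bar>int n\<bar> + \<bar>int n\<bar>}"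
  have f: "?f r = qpoch fps_X fps_X (2 * n) * refl_term (int n) (int n) r" for r
    unfolding qbinom_refl_shift refl_term_def refl_coeff_def by (simp add: mult_ac)
  have "CP 3 1 n = refl_sum (int n) (int n)"
    using bounded_cyl_gf_eq_refl_sum[of n n] by (simp add: bounded_cyl_gf_diag)
  then have "sum ?f ?R = qpoch fps_X fps_X (2 * n) * CP 3 1 n"
    unfolding f refl_sum_def by (simp only: sum_distrib_left)
  moreover have "?f r = 0" if "r \<in> UNIV - ?R" for r
    unfolding f using that by (subst refl_term_eq_0) auto
  ultimately show ?thesis
    \<comment> \<open>All terms outside the finite range vanish, so the bilateral sum involves no
      limit of power series.\<close>
    by (intro has_sum_finite_neutralI[of ?R]) auto
qed

end
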